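(* Each of the five families of subsets $(sS_n)_{n\ge1}$, $(cS_n)_{n\ge1}$, $(gS_n)_{n\ge1}$, $(bS_n)_{n\ge1}$, $(tS_n)_{n\ge1}$ of the symmetric groups $\Sigma_n$ has exponential growth.
   Context: Permutations act on $[n]=\{1,\dots,n\}$; products are composed right to left, $(\alpha\beta)(x)=\alpha(\beta(x))$. A segment is a set $\{i,i+1,\dots,j\}\subseteq[n]$. (s) $\pi\in\Sigma_n$ is segment-simple ($\pi\in sS_n$) if there is no segment $I\subseteq[n]$ with $1<|I|<n$ such that $\pi(I)$ is also a segment. (c) $\pi$ is cycle-simple ($\pi\in cS_n$) if its disjoint cycle decomposition contains at most one cycle of length $\ge2$. (g) $\pi$ is group-simple ($\pi\in gS_n$) if the cyclic subgroup generated by $\pi$ is a simple group (the identity counts as group-simple). (b) Let $\tau_i=(i,i+1)$ and $D(k,j)=\tau_k\tau_{k-1}\cdots\tau_j$ for $1\le j\le k\le n-1$. Every $\pi\ne \mathrm{Id}$ has a unique expression $\pi=D(k_1,j_1)D(k_2,j_2)\cdots D(k_s,j_s)$ with $1\le k_1<k_2<\dots<k_s\le n-1$, $j_a\le k_a$, whose number of letters equals the Coxeter length of $\pi$ (this is the length-lexicographically smallest reduced word for the order $\tau_1<\dots<\tau_{n-1}$). $\pi$ is braid-simple ($\pi\in bS_n$) if $\pi=\mathrm{Id}$ or each $\tau_i$ occurs at most once in this word. (t) Write each cycle of $\pi$ (including fixed points) starting with its largest element, order the cycles by increasing largest element, and erase parentheses to obtain a word $w$ in the letters $[n]$. Define a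 binary tree $T(w)$ recursively: $T(\emptyset)=\emptyset$; otherwise, writing $w=usv$ with $s$ the smallest letter, $T(w)$ has root $s$, left subtree $T(u)$ and right subtree $T(v)$. Set $T(\pi)=T(w)$. $\pi$ is tree-simple ($\pi\in tS_n$) if every vertex of $T(\pi)$ has degree $1$ or $2$ as a graph vertex (for $n=1$ the one-vertex tree counts as tree-simple). A family $(A_n)$ with $A_n\subseteq\Sigma_n$ has exponential growth if there are constants $a>0$, $b>1$ with $|A_n|\ge a\,b^n$ for all sufficiently large $n$. *)

theory Defs
  imports
    Complex_Main
    "HOL-Library.Tree"
    "HOL-Combinatorics.Combinatorics"
    "HOL-Algebra.Algebra"
begin

definition segment :: "nat \<Rightarrow> nat set \<Rightarrow> bool"
  where "segment n I \<longleftrightarrow> (\<exists>i j. 1 \<le> i \<and> i \<le> j \<and> j \<le> n \<and> I = {i..j})"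

definition sS :: "nat \<Rightarrow> (nat \<Rightarrow> nat) set"
  where "sS n = {\<pi>. \<pi> permutes {1..n} \<and>
    \<not> (\<exists>I. segment n I \<and> 1 < card I \<and> card I < n \<and> segment n (\<pi> ` I))}"

(* The disjoint cycles of \<pi>, fixed points included, each written as the list
   [m, \<pi> m, \<pi> (\<pi> m), ...] starting with its largest element m, and listed by increasing m.
   The library's  support \<pi> m  is exactly this list for the cycle through m. *)
definition canonical_cycles :: "nat \<Rightarrow> (nat \<Rightarrow> nat) \<Rightarrow> nat list list"
  where "canonical_cycles n \<pi> =
    map (support \<pi>) (filter (\<lambda>m. \<forall>x \<in> set (support \<pi> m). x \<le> m) [1..<Suc n])"

definition cS :: "nat \<Rightarrow> (nat \<Rightarrow> nat) set"
  where "cS n = {\<pi>. \<pi> permutes {1..n} \<and>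
    length (filter (\<lambda>c. 2 \<le> length c) (canonical_cycles n \<pi>)) \<le> 1}"

(* The identity is listed separately because simple_group excludes the trivial group. *)
definition gS :: "nat \<Rightarrow> (nat \<Rightarrow> nat) set"
  where "gS n = {\<pi>. \<pi> permutes {1..n} \<and>
    (\<pi> = id \<or> simple_group (subgroup_generated (sym_group n) {\<pi>}))}"

(* A word in the generators is a list of indices, the letter i standing for the
   transposition (i, i+1); its value is the product composed right to left. *)
definition word_perm :: "nat list \<Rightarrow> nat \<Rightarrow> nat"
  where "word_perm w = foldr (\<lambda>i p. transpose i (Suc i) \<circ> p) w id"

definition coxeter_length :: "nat \<Rightarrow> (nat \<Rightarrow> nat) \<Rightarrow> nat"
  where "coxeter_length n \<pi> =
    (LEAST l. \<exists>w. length w = l \<and> set w \<subseteq> {1..<n} \<and> word_perm w = \<pi>)"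

(* D k j is the word k, k-1, ..., j. *)
definition D :: "nat \<Rightarrow> nat \<Rightarrow> nat list"
  where "D k j = rev [j..<Suc k]"

definition D_word :: "(nat \<times> nat) list \<Rightarrow> nat list"
  where "D_word ks = concat (map (\<lambda>(k, j). D k j) ks)"

definition D_indices :: "nat \<Rightarrow> (nat \<times> nat) list \<Rightarrow> bool"
  where "D_indices n ks \<longleftrightarrow>
    sorted_wrt (<) (map fst ks) \<and> (\<forall>(k, j) \<in> set ks. 1 \<le> j \<and> j \<le> k \<and> k < n)"

definition braid_normal_form :: "nat \<Rightarrow> (nat \<Rightarrow> nat) \<Rightarrow> nat list \<Rightarrow> bool"
  where "braid_normal_form n \<pi> w \<longleftrightarrow>
    (\<exists>ks. D_indices n ks \<and> w = D_word ks) \<and> word_perm w = \<pi> \<and>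
    length w = coxeter_length n \<pi>"

(* The existential ranges over at most one word: see braid_normal_form_unique below. *)
definition bS :: "nat \<Rightarrow> (nat \<Rightarrow> nat) set"
  where "bS n = {\<pi>. \<pi> permutes {1..n} \<and>
    (\<pi> = id \<or> (\<exists>w. braid_normal_form n \<pi> w \<and> distinct w))}"

lemma word_perm_append: "word_perm (u @ v) = word_perm u \<circ> word_perm v"
  by (induction u) (auto simp: word_perm_def comp_assoc)

lemma bij_word_perm: "bij (word_perm w)"
proof (induction w)
  case Nil
  have "word_perm [] = id" by (simp add: word_perm_def)
  then show ?case by (metis bij_id)
next
  case (Cons i w)
  have "word_perm (i # w) = transpose i (Suc i) \<circ> word_perm w" by (simp add: word_perm_def)
  then show ?case using bij_comp[OF Cons bij_transpose] by metis
qed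

lemma word_perm_fixes: "(\<And>i. i \<in> set w \<Longrightarrow> Suc i < x) \<Longrightarrow> word_perm w x = x"
  by (induction w) (force simp: word_perm_def transpose_def)+

lemma word_perm_D: "j \<le> k \<Longrightarrow> word_perm (D k j) j = Suc k"
proof (induction k rule: dec_induct)
  case base
  then show ?case by (simp add: D_def word_perm_def)
next
  case (step k)
  then have "D (Suc k) j = [Suc k] @ D k j" by (simp add: D_def)
  then show ?case using step by (simp add: word_perm_append) (simp add: word_perm_def)
qed

lemma D_word_snoc: "D_word (ks @ [(k, j)]) = D_word ks @ D k j"
  by (simp add: D_word_def)

lemma D_indices_snocD:
  assumes "D_indices n (ks @ [(k, j)])"
  shows "D_indices n ks" "j \<le> k"
    and "word_perm (D_word (ks @ [(k, j)])) j = Suc k"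
    and "\<And>x. Suc k < x \<Longrightarrow> word_perm (D_word (ks @ [(k, j)])) x = x"
proof -
  show "D_indices n ks" and jk: "j \<le> k"
    using assms by (auto simp: D_indices_def sorted_wrt_append)
  have lt: "i < k" if "i \<in> set (D_word ks)" for i
    using that assms by (force simp: D_word_def D_def D_indices_def sorted_wrt_append)
  then have "word_perm (D_word ks) (Suc k) = Suc k" by (intro word_perm_fixes) auto
  then show "word_perm (D_word (ks @ [(k, j)])) j = Suc k"
    using jk by (simp add: D_word_snoc word_perm_append word_perm_D)
  show "word_perm (D_word (ks @ [(k, j)])) x = x" if "Suc k < x" for x
    by (rule word_perm_fixes) (use lt that in \<open>fastforce simp: D_word_snoc D_def\<close>)
qed

lemma D_indices_inj:
  assumes "D_indices n ks" "D_indices n ks'" "word_perm (D_word ks) = word_perm (D_word ks')"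
  shows "ks = ks'"
  using assms
proof (induction ks arbitrary: ks' rule: rev_induct)
  case Nil
  show ?case
  proof (cases ks' rule: rev_cases)
    case (snoc qs kj)
    obtain k j where "kj = (k, j)" by fastforce
    with snoc have ks': "ks' = qs @ [(k, j)]" by simp
    have "word_perm (D_word ks') j = j"
      unfolding Nil.prems(3)[symmetric] by (simp add: D_word_def word_perm_def)
    then show ?thesis using D_indices_snocD(2,3)[OF Nil.prems(2)[unfolded ks']] ks' by simp
  qed simp
next
  case (snoc kj ks)
  obtain k j where kj: "kj = (k, j)" by fastforce
  note 1 = D_indices_snocD[OF snoc.prems(1)[unfolded kj]]
  show ?case
  proof (cases ks' rule: rev_cases)
    case Nil
    then show ?thesis using 1(2,3) snoc.prems(3) kj by (auto simp: D_word_def word_perm_def)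
  next
    case (snoc qs kj')
    obtain k' j' where kj': "kj' = (k', j')" by fastforce
    have ks': "ks' = qs @ [(k', j')]" using snoc kj' by simp
    note 2 = D_indices_snocD[OF snoc.prems(2)[unfolded ks']]
    let ?p = "word_perm (D_word ks')"
    have p: "word_perm (D_word (ks @ [(k, j)])) = ?p" using snoc.prems(3) kj by simp
    have inj: "inj ?p" using bij_word_perm by (rule bij_is_inj)
    note 1 = 1[unfolded p] and 2 = 2[folded ks']
    have "\<not> k < k'" using 1(4)[of "Suc k'"] 2(2,3) injD[OF inj, of "Suc k'" j'] by auto
    moreover have "\<not> k' < k" using 2(4)[of "Suc k"] 1(2,3) injD[OF inj, of "Suc k" j] by auto
    ultimately have k: "k' = k" by simp
    have j: "j' = j" using 1(3) 2(3) k injD[OF inj, of j j'] by simp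
    have "word_perm (D_word ks) \<circ> word_perm (D k j) = word_perm (D_word qs) \<circ> word_perm (D k j)"
      using p by (simp add: ks' k j D_word_snoc word_perm_append)
    then have "word_perm (D_word ks) = word_perm (D_word qs)"
      by (metis bij_word_perm bij_is_surj surj_fun_eq)
    then show ?thesis using snoc.IH[OF 1(1) 2(1)] ks' kj k j by simp
  qed
qed

lemma braid_normal_form_unique:
  "braid_normal_form n \<pi> w \<Longrightarrow> braid_normal_form n \<pi> w' \<Longrightarrow> w = w'"
  unfolding braid_normal_form_def using D_indices_inj by metis

(* Only used for words without repeated letters, so the factorization w = u s v
   at the smallest letter s is unambiguous. *)
function word_tree :: "nat list \<Rightarrow> nat tree"
  where
    "word_tree [] = Leaf"
  | "w \<noteq> [] \<Longrightarrow> word_tree w =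
      (let s = Min (set w)
       in Node (word_tree (takeWhile (\<lambda>x. x \<noteq> s) w)) s
               (word_tree (tl (dropWhile (\<lambda>x. x \<noteq> s) w))))"
  by auto
termination
proof (relation "measure length")
  fix w :: "nat list" and s
  assume w: "w \<noteq> []" and s: "s = Min (set w)"
  then have "s \<in> set w" by simp
  then show "(takeWhile (\<lambda>x. x \<noteq> s) w, w) \<in> measure length"
    by (induction w) auto
  have "length (dropWhile (\<lambda>x. x \<noteq> s) w) \<le> length w" by (rule length_dropWhile_le)
  then show "(tl (dropWhile (\<lambda>x. x \<noteq> s) w), w) \<in> measure length"
    using w by (cases w) auto
qed simp

fun root_set :: "'a tree \<Rightarrow> 'a set"
  where
    "root_set Leaf = {}"
  | "root_set (Node l a r) = {a}"

(* Vertices are identified with their labels, which are distinct in all trees considered. *)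
fun tree_edges :: "'a tree \<Rightarrow> 'a set set"
  where
    "tree_edges Leaf = {}"
  | "tree_edges (Node l a r) =
      (\<lambda>b. {a, b}) ` (root_set l \<union> root_set r) \<union> tree_edges l \<union> tree_edges r"

definition tree_degree :: "'a tree \<Rightarrow> 'a \<Rightarrow> nat"
  where "tree_degree t v = card {e \<in> tree_edges t. v \<in> e}"

definition perm_tree :: "nat \<Rightarrow> (nat \<Rightarrow> nat) \<Rightarrow> nat tree"
  where "perm_tree n \<pi> = word_tree (concat (canonical_cycles n \<pi>))"

definition tS :: "nat \<Rightarrow> (nat \<Rightarrow> nat) set"
  where "tS n = {\<pi>. \<pi> permutes {1..n} \<and>
    (n = 1 \<or> (\<forall>v \<in> set_tree (perm_tree n \<pi>). tree_degree (perm_tree n \<pi>) v \<in> {1, 2}))}"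

definition exponential_growth :: "(nat \<Rightarrow> (nat \<Rightarrow> nat) set) \<Rightarrow> bool"
  where "exponential_growth A \<longleftrightarrow>
    (\<exists>a b :: real. a > 0 \<and> b > 1 \<and> (\<forall>\<^sub>F n in sequentially. real (card (A n)) \<ge> a * b ^ n))"

end

(* Four of the families contain a subfamily indexed by the subsets of a set with at least n div 2
   elements. Products of the disjoint transpositions (2k+1, 2k+2) generate groups of order 2. An
   increasing word is the normal form of its value, because every word for that value must contain
   each of its letters. A cycle (n, b_1, ..., b_r) with n > b_1 > ... > b_r is cycle-simple, and its
   canonical word increases up to n and then decreases, so its tree is a path. For
   segment-simplicity, append a new last value to the one-line notation of a segment-simple
   permutation: this preserves simplicity unless the value is extreme or adjacent to the previous
   last value, which leaves n - 3 choices. *)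
theory Submission
  imports Defs
begin

section \<open>Exponential growth\<close>

text \<open>Rounding n / 2 down costs at most a factor \<open>sqrt 2\<close>, so the base
  \<open>sqrt 2\<close> with the constant \<open>1 / 2\<close> works.\<close>

lemma exponential_growthI:
  assumes "\<And>n. N \<le> n \<Longrightarrow> 2 ^ (n div 2) \<le> card (A n)"
  shows "exponential_growth A"
proof -
  have "1 / 2 * sqrt 2 ^ n \<le> real (card (A n))" if "N \<le> n" for n
  proof -
    have "sqrt 2 ^ n = sqrt 2 ^ (2 * (n div 2)) * sqrt 2 ^ (n mod 2)"
      by (metis mult_div_mod_eq power_add)
    also have "\<dots> \<le> 2 ^ (n div 2) * 2"
    proof (rule mult_mono)
      show "sqrt 2 ^ (n mod 2) \<le> 2"
        by (cases "even n") (auto simp: mod2_eq_if real_le_lsqrt)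
    qed (simp_all add: power_mult)
    also have "2 ^ (n div 2) \<le> real (card (A n))"
      using assms[OF that] by (metis of_nat_le_iff of_nat_numeral of_nat_power)
    finally show ?thesis by simp
  qed
  then have "\<forall>\<^sub>F n in sequentially. 1 / 2 * sqrt 2 ^ n \<le> real (card (A n))"
    unfolding eventually_sequentially by blast
  then show ?thesis
    unfolding exponential_growth_def by (intro exI[of _ "1/2"] exI[of _ "sqrt 2"]) auto
qed

text \<open>The left inverse \<open>g n\<close> recovers the chosen subset from the permutation,
  which makes \<open>f n\<close> injective on \<open>Pow (U n)\<close>.\<close>

lemma exponential_growth_subsetsI:
  assumes mem: "\<And>n S. N \<le> n \<Longrightarrow> S \<subseteq> U n \<Longrightarrow> f n S \<in> A n"
    and inverse: "\<And>n S. N \<le> n \<Longrightarrow> S \<subseteq> U n \<Longrightarrow> g n (f n S) = S"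
    and U: "\<And>n. finite (U n)" "\<And>n. n div 2 \<le> card (U n)"
    and perm: "\<And>n p. p \<in> A n \<Longrightarrow> p permutes {1..n}"
  shows "exponential_growth A"
proof (rule exponential_growthI)
  fix n assume n: "N \<le> n"
  \<comment> \<open>Finiteness matters: an infinite set has \<open>card\<close> 0.\<close>
  have "finite (A n)"
    by (rule finite_subset[OF _ finite_permutations[of "{1..n}"]]) (use perm in auto)
  moreover have "inj_on (f n) (Pow (U n))"
    by (rule inj_on_inverseI[of _ "g n"]) (use inverse[OF n] in auto)
  moreover have "f n ` Pow (U n) \<subseteq> A n" using mem[OF n] by auto
  ultimately have card_le: "card (Pow (U n)) \<le> card (A n)" by (simp add: card_inj_on_le)
  have "2 ^ (n div 2) \<le> (2::nat) ^ card (U n)" using U(2) by simp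
  also have "\<dots> \<le> card (A n)" using card_le U(1) by (simp add: card_Pow)
  finally show "2 ^ (n div 2) \<le> card (A n)" .
qed

section \<open>Group-simple permutations\<close>

text \<open>For p other than the identity the generated group is {id, p}, of prime order 2.\<close>

lemma involution_in_gS:
  assumes p: "p permutes {1..n}" and pp: "p \<circ> p = id"
  shows "p \<in> gS n"
proof (cases "p = id")
  case False
  interpret G: group "sym_group n" by (rule sym_group_is_group)
  let ?H = "subgroup_generated (sym_group n) {p}"
  interpret H: group ?H by simp
  have pG: "p \<in> carrier (sym_group n)" using p by (simp add: sym_group_carrier)
  have "subgroup {id, p} (sym_group n)"
  proof (rule G.subgroupI)
    fix a assume "a \<in> {id, p}"
    then have "a \<in> carrier (sym_group n)" "a \<circ> a = id"
      using pG pp by (auto simp: sym_group_carrier permutes_id)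
    then have "inv\<^bsub>sym_group n\<^esub> a = a"
      by (intro G.inv_equality) (auto simp: sym_group_mult sym_group_one)
    then show "inv\<^bsub>sym_group n\<^esub> a \<in> {id, p}" using \<open>a \<in> {id, p}\<close> by simp
  qed (use pG pp in \<open>auto simp: sym_group_carrier permutes_id sym_group_mult\<close>)
  then have "carrier ?H \<subseteq> {id, p}" by (intro G.subgroup_generated_minimal) auto
  moreover have "p \<in> carrier ?H"
    using G.carrier_subgroup_generated_subset pG
    by (simp add: carrier_subgroup_generated generate.incl)
  moreover have "id \<in> carrier ?H"
    using H.one_closed by (simp add: sym_group_one)
  ultimately have "carrier ?H = {id, p}" by auto
  then have "order ?H = 2" using False by (simp add: order_def)
  then have "simple_group ?H" by (intro H.prime_order_simple) (simp add: two_is_prime_nat)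
  then show ?thesis using p by (simp add: gS_def)
qed (use p in \<open>simp add: gS_def\<close>)

text \<open>If S has no two consecutive elements, this is the product of the disjoint transpositions
  (x, x + 1) with x \<in> S.\<close>

definition adjacent_swaps :: "nat set \<Rightarrow> nat \<Rightarrow> nat"
  where "adjacent_swaps S x = (if x \<in> S then Suc x else if x \<in> Suc ` S then x - 1 else x)"

lemma adjacent_swaps_in_gS:
  assumes S: "S \<subseteq> (\<lambda>k. 2 * k + 1) ` {..<n div 2}"
  shows "adjacent_swaps S \<in> gS n"
proof -
  have odd: "odd x" "x < n" "x \<ge> 1" if "x \<in> S" for x using S that by auto
  \<comment> \<open>The elements of S are odd, so the transposed pairs do not overlap.\<close>
  then have Suc: "Suc x \<notin> S" if "x \<in> S" for x using that odd(1)[of x] odd(1)[of "Suc x"] by auto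
  have inv: "adjacent_swaps S (adjacent_swaps S x) = x" for x
    using Suc by (auto simp: adjacent_swaps_def)
  have "adjacent_swaps S permutes {1..n}"
  proof (rule bij_imp_permutes)
    have "adjacent_swaps S x \<in> {1..n}" if "x \<in> {1..n}" for x
      using that odd by (force simp: adjacent_swaps_def)
    then show "bij_betw (adjacent_swaps S) {1..n} {1..n}"
      by (intro bij_betwI[of _ _ _ "adjacent_swaps S"]) (auto simp: inv)
    show "adjacent_swaps S x = x" if "x \<notin> {1..n}" for x
      using that odd by (force simp: adjacent_swaps_def)
  qed
  then show ?thesis using inv by (intro involution_in_gS) (auto simp: fun_eq_iff)
qed

lemma exponential_growth_gS: "exponential_growth gS"
proof (rule exponential_growth_subsetsI)
  show "adjacent_swaps S \<in> gS n" if "S \<subseteq> (\<lambda>k. 2 * k + 1) ` {..<n div 2}" for n S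
    using that by (rule adjacent_swaps_in_gS)
  \<comment> \<open>S is read off as the set of points that move up.\<close>
  show "{x. x < adjacent_swaps S x} = S" for S
    by (auto simp: adjacent_swaps_def split: if_splits)
  show "n div 2 \<le> card ((\<lambda>k. 2 * k + 1) ` {..<n div 2})" for n :: nat
    by (subst card_image) (auto intro: inj_onI)
qed (auto simp: gS_def)

section \<open>Braid-simple permutations\<close>

lemma word_perm_Nil [simp]: "word_perm [] = id"
  by (simp add: word_perm_def)

lemma word_perm_Cons: "word_perm (i # w) = transpose i (Suc i) \<circ> word_perm w"
  by (simp add: word_perm_def)

text \<open>Only the letter i carries points across the cut between i and i + 1.\<close>

lemma word_perm_le_iff:
  assumes "i \<notin> set w"
  shows "word_perm w x \<le> i \<longleftrightarrow> x \<le> i"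
  using assms
proof (induction w)
  case (Cons j w)
  then have "transpose j (Suc j) y \<le> i \<longleftrightarrow> y \<le> i" for y
    by (auto simp: transpose_def)
  then show ?case using Cons by (simp add: word_perm_Cons)
qed simp

text \<open>Split the word at the single occurrence of i: the point that v sends to i starts at or
  below the cut, the letter i lifts it to i + 1, and u cannot bring it back. Hence the value
  determines the letters.\<close>

lemma letters_of_distinct_word:
  assumes "distinct w"
  shows "{i. \<exists>x\<le>i. i < word_perm w x} = set w"
proof (intro equalityI subsetI)
  show "i \<in> set w" if "i \<in> {i. \<exists>x\<le>i. i < word_perm w x}" for i
    using that word_perm_le_iff[of i w] by (auto simp flip: not_le)
  fix i assume "i \<in> set w"
  then obtain u v where w: "w = u @ i # v" by (meson split_list)
  then have i: "i \<notin> set u" "i \<notin> set v" using assms by auto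
  obtain x where x: "word_perm v x = i" by (metis bij_pointE bij_word_perm)
  have "x \<le> i" using word_perm_le_iff[OF i(2), of x] x by simp
  moreover have "word_perm w x = word_perm u (Suc i)"
    by (simp add: w word_perm_append word_perm_Cons x)
  moreover have "i < word_perm u (Suc i)"
    using word_perm_le_iff[OF i(1), of "Suc i"] by (simp flip: not_le)
  ultimately show "i \<in> {i. \<exists>x\<le>i. i < word_perm w x}" by auto
qed

lemma coxeter_length_distinct_word:
  assumes "distinct w" "set w \<subseteq> {1..<n}"
  shows "coxeter_length n (word_perm w) = length w"
  unfolding coxeter_length_def
proof (rule Least_equality)
  fix l assume "\<exists>w'. length w' = l \<and> set w' \<subseteq> {1..<n} \<and> word_perm w' = word_perm w"
  then obtain w' where w': "length w' = l" "word_perm w' = word_perm w" by blast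
  have "set w = {i. \<exists>x\<le>i. i < word_perm w' x}"
    using letters_of_distinct_word[OF assms(1)] w'(2) by simp
  \<comment> \<open>This half holds for any word, with repetitions or not: a crossed cut needs its
    letter.\<close>
  also have "\<dots> \<subseteq> set w'"
    using word_perm_le_iff[of _ w'] by (auto simp flip: not_le)
  finally have "card (set w) \<le> card (set w')" by (simp add: card_mono)
  also have "\<dots> \<le> l" using card_length w'(1) by blast
  finally show "length w \<le> l" using assms(1) by (simp add: distinct_card)
qed (use assms in blast)

lemma word_perm_permutes: "set w \<subseteq> {1..<n} \<Longrightarrow> word_perm w permutes {1..n}"
proof (induction w)
  case Nil
  show ?case unfolding word_perm_Nil by (rule permutes_id)
next
  case (Cons i w)
  then have "transpose i (Suc i) permutes {1..n}" by (intro permutes_swap_id) auto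
  moreover have "word_perm w permutes {1..n}" using Cons by simp
  ultimately show ?case unfolding word_perm_Cons by (intro permutes_compose)
qed

lemma increasing_word_in_bS:
  assumes "sorted_wrt (<) w" "set w \<subseteq> {1..<n}"
  shows "word_perm w \<in> bS n"
proof -
  have dist: "distinct w" using assms(1) by (simp add: strict_sorted_iff)
  \<comment> \<open>A letter k is the one-letter factor \<open>D k k\<close>, so an increasing word
    already has the shape of a normal form.\<close>
  have "D_word (map (\<lambda>k. (k, k)) w) = w"
    by (induction w) (simp_all add: D_word_def D_def)
  moreover have "D_indices n (map (\<lambda>k. (k, k)) w)"
    using assms by (auto simp: D_indices_def comp_def)
  ultimately have "braid_normal_form n (word_perm w) w"
    unfolding braid_normal_form_def
    using coxeter_length_distinct_word[OF dist assms(2)] by metis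
  then show ?thesis
    using word_perm_permutes[OF assms(2)] dist by (auto simp: bS_def)
qed

lemma exponential_growth_bS: "exponential_growth bS"
proof (rule exponential_growth_subsetsI)
  fix n and S :: "nat set"
  assume S: "S \<subseteq> {1..<n}"
  let ?w = "filter (\<lambda>i. i \<in> S) [1..<n]"
  show "word_perm ?w \<in> bS n"
    by (rule increasing_word_in_bS) (auto intro: sorted_wrt_filter)
  show "{i. \<exists>x\<le>i. i < word_perm ?w x} = S"
    using letters_of_distinct_word[of ?w] S by auto
qed (auto simp: bS_def)

section \<open>Descending cycles\<close>

lemma support_fixpoint: "p x = x \<Longrightarrow> support p x = [x]"
  using least_power_le[of 1 p x] least_powerI(2)[of 1 p x] by (simp add: le_Suc_eq)

text \<open>The i-th power of the cycle rotates the list by i places, so the orbit of x runs through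
  the entries in order and, by distinctness, closes up only after a full turn.\<close>

lemma support_cycle_of_list:
  assumes "distinct (x # xs)"
  shows "support (cycle_of_list (x # xs)) x = x # xs"
proof -
  let ?cs = "x # xs"
  let ?p = "cycle_of_list ?cs"
  have power: "(?p ^^ i) x = ?cs ! (i mod length ?cs)" for i
  proof -
    have "(?p ^^ i) x = hd (map (?p ^^ i) ?cs)" by simp
    also have "\<dots> = hd (rotate i ?cs)" by (simp only: cyclic_rotation[OF assms])
    finally show ?thesis by (simp add: hd_rotate_conv_nth)
  qed
  have "least_power ?p x = length ?cs"
    unfolding least_power_def
  proof (rule Least_equality)
    show "(?p ^^ length ?cs) x = x \<and> 0 < length ?cs"
      using cycle_is_id_root[OF assms] by simp
    fix k assume k: "(?p ^^ k) x = x \<and> 0 < k"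
    then have "?cs ! (k mod length ?cs) = ?cs ! 0" by (simp add: power)
    then have "k mod length ?cs = 0"
      using nth_eq_iff_index_eq[OF assms, of "k mod length ?cs" 0] by fastforce
    then show "length ?cs \<le> k" using k by (auto intro: dvd_imp_le)
  qed
  then have "support ?p x = map ((!) ?cs) [0..<length ?cs]"
    by (intro map_cong) (simp_all only: power mod_less set_upt atLeastLessThan_iff)
  then show ?thesis by (simp only: map_nth)
qed

text \<open>Rotate the list so that x comes first; the cycle stays the same, and the orbit of x is
  the whole list, whereas a fixed point has a one-element orbit.\<close>

lemma cycle_of_list_moves:
  assumes "distinct cs" "2 \<le> length cs" "x \<in> set cs"
  shows "cycle_of_list cs x \<noteq> x"
proof
  assume fixed: "cycle_of_list cs x = x"
  obtain ys zs where cs: "cs = ys @ x # zs" using assms(3) by (meson split_list)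
  have "cycle_of_list cs = cycle_of_list (x # zs @ ys)"
    using cycle_of_list_rotate_independent[OF assms(1), of "length ys"]
    by (simp add: cs rotate_append)
  moreover have "distinct (x # zs @ ys)" using assms(1) cs by auto
  ultimately have "support (cycle_of_list cs) x = x # zs @ ys"
    using support_cycle_of_list by metis
  then have "zs @ ys = []" using support_fixpoint[of "cycle_of_list cs" x, OF fixed] by simp
  then show False using assms(2) cs by simp
qed

text \<open>Headed by its largest entry, the list is already in the form in which
  \<open>canonical_cycles\<close> writes its cycle.\<close>

definition descending_list :: "nat \<Rightarrow> nat set \<Rightarrow> nat list"
  where "descending_list n B = n # rev (filter (\<lambda>x. x \<in> B) [1..<n])"

lemma distinct_descending_list: "distinct (descending_list n B)"
  by (simp add: descending_list_def)

lemma set_descending_list: "B \<subseteq> {1..<n} \<Longrightarrow> set (descending_list n B) = insert n B"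
  by (auto simp: descending_list_def)

text \<open>This decodes B. The point n is removed because it moves too whenever B is
  nonempty.\<close>

lemma moved_by_descending_cycle:
  assumes "B \<subseteq> {1..<n}"
  shows "{x. cycle_of_list (descending_list n B) x \<noteq> x} - {n} = B"
proof (intro equalityI subsetI)
  show "x \<in> B" if "x \<in> {x. cycle_of_list (descending_list n B) x \<noteq> x} - {n}" for x
    using that id_outside_supp set_descending_list[OF assms] by fastforce
  fix x assume x: "x \<in> B"
  have fin: "finite B" using assms finite_subset by blast
  have "length (descending_list n B) = card (insert n B)"
    using distinct_card[OF distinct_descending_list] set_descending_list[OF assms] by metis
  also have "\<dots> \<ge> 2"
    using x assms fin by (subst card_insert_disjoint) (auto simp: Suc_le_eq card_gt_0_iff)
  finally show "x \<in> {x. cycle_of_list (descending_list n B) x \<noteq> x} - {n}"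
    using x assms cycle_of_list_moves[OF distinct_descending_list, of n B x]
    by (auto simp: set_descending_list[OF assms])
qed

lemma descending_cycle_permutes:
  assumes "B \<subseteq> {1..<n}" "1 \<le> n"
  shows "cycle_of_list (descending_list n B) permutes {1..n}"
  by (rule permutes_subset[OF cycle_permutes])
    (use assms in \<open>auto simp: set_descending_list[OF assms(1)]\<close>)

text \<open>Points below n outside B are fixed and give singletons; those in B share the cycle of n
  and are not its maximum, so that cycle is listed once, at the end.\<close>

lemma canonical_cycles_descending_cycle:
  assumes B: "B \<subseteq> {1..<n}" and n: "1 \<le> n"
  shows "canonical_cycles n (cycle_of_list (descending_list n B)) =
    map (\<lambda>x. [x]) (filter (\<lambda>x. x \<notin> B) [1..<n]) @ [descending_list n B]"
proof -
  let ?p = "cycle_of_list (descending_list n B)"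
  let ?max = "\<lambda>m. \<forall>x \<in> set (support ?p m). x \<le> m"
  have supp_n: "support ?p n = descending_list n B"
    using support_cycle_of_list distinct_descending_list unfolding descending_list_def by metis
  have supp_fixed: "support ?p m = [m]" if "m \<in> {1..<n} - B" for m
    by (rule support_fixpoint[OF id_outside_supp]) (use that set_descending_list[OF B] in auto)
  \<comment> \<open>Lying in the same orbit is a symmetric relation.\<close>
  have "n \<in> set (support ?p m)" if "m \<in> B" for m
  proof -
    have "m \<in> set (support ?p n)"
      using that set_descending_list[OF B] supp_n by auto
    then show ?thesis
      using disjoint_support'[OF permutation_of_cycle] by (metis inf_commute)
  qed
  then have not_max: "\<not> ?max m" if "m \<in> B" for m using that B by fastforce
  have max: "?max m \<longleftrightarrow> m \<notin> B" if "m \<in> set [1..<n]" for m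
  proof (cases "m \<in> B")
    case False
    then show ?thesis using supp_fixed[of m] that by simp
  qed (use not_max in blast)
  have max_n: "?max n"
    unfolding supp_n set_descending_list[OF B] using B by auto
  have "filter ?max [1..<Suc n] = filter (\<lambda>m. m \<notin> B) [1..<n] @ [n]"
    by (simp only: upt_Suc_append[OF n] filter_append filter.simps if_P[OF max_n]
        filter_cong[OF refl max])
  then show ?thesis
    unfolding canonical_cycles_def using supp_fixed supp_n by auto
qed

lemma exponential_growth_cS: "exponential_growth cS"
proof (rule exponential_growth_subsetsI[where N = 1])
  fix n and B :: "nat set"
  assume B: "1 \<le> n" "B \<subseteq> {1..<n}"
  show "cycle_of_list (descending_list n B) \<in> cS n"
    using B
    by (simp add: cS_def descending_cycle_permutes canonical_cycles_descending_cycle filter_map comp_def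
        del: One_nat_def)
  show "{x. cycle_of_list (descending_list n B) x \<noteq> x} - {n} = B"
    using B(2) by (rule moved_by_descending_cycle)
qed (auto simp: cS_def)

section \<open>Tree-simple permutations\<close>

text \<open>One subtree of each node is empty, so the root is an end of the path. The label
  condition keeps labels distinct, as \<open>tree_degree\<close> identifies vertices with
  labels.\<close>

fun path_tree :: "'a tree \<Rightarrow> bool"
  where
    "path_tree Leaf \<longleftrightarrow> True"
  | "path_tree (Node l a r) \<longleftrightarrow>
      a \<notin> set_tree l \<union> set_tree r \<and> (l = Leaf \<and> path_tree r \<or> r = Leaf \<and> path_tree l)"

lemma tree_edge_subset: "e \<in> tree_edges t \<Longrightarrow> e \<subseteq> set_tree t"
proof (induction t)
  case (Node l a r)
  moreover have "root_set s \<subseteq> set_tree s" for s :: "'a tree" by (cases s) auto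
  ultimately show ?case by fastforce
qed simp

lemma finite_tree_edges: "finite (tree_edges t)"
proof (induction t)
  case (Node l a r)
  moreover have "finite (root_set s)" for s :: "'a tree" by (cases s) auto
  ultimately show ?case by simp
qed simp

text \<open>The bound at the root drives the induction: a new root adds a single edge and raises the
  degree of the old root from at most 1 to at most 2. A lone vertex has degree 0, hence the
  condition on the lower bound.\<close>

lemma tree_degree_path_tree:
  assumes "path_tree t" "v \<in> set_tree t"
  shows "tree_degree t v \<le> 2 \<and> (v \<in> root_set t \<longrightarrow> tree_degree t v \<le> 1) \<and>
    (set_tree t \<noteq> {v} \<longrightarrow> 1 \<le> tree_degree t v)"
  using assms
proof (induction t arbitrary: v)
  case (Node l a r)
  \<comment> \<open>\<open>s\<close> is the subtree that may be nonempty; if both are empty it is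
    \<open>Leaf\<close>.\<close>
  define s where "s = (if l = Leaf then r else l)"
  have s: "path_tree s" "a \<notin> set_tree s" "set_tree (Node l a r) = insert a (set_tree s)"
    "tree_edges (Node l a r) = (\<lambda>b. {a, b}) ` root_set s \<union> tree_edges s"
    using Node.prems(1) by (auto simp: s_def)
  have IH: "tree_degree s w \<le> 2 \<and> (w \<in> root_set s \<longrightarrow> tree_degree s w \<le> 1) \<and>
    (set_tree s \<noteq> {w} \<longrightarrow> 1 \<le> tree_degree s w)" if "w \<in> set_tree s" for w
    using Node.IH s(1) that unfolding s_def by (auto split: if_splits)
  show ?case
  proof (cases s)
    case Leaf
    then have "set_tree (Node l a r) = {a}" "tree_edges (Node l a r) = {}"
      using s(3,4) by simp_all
    moreover from this have "v = a" using Node.prems(2) by blast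
    ultimately show ?thesis unfolding tree_degree_def by (simp del: tree_edges.simps tree.set)
  next
    case (Node ls b rs)
    then have b: "root_set s = {b}" "b \<in> set_tree s" by simp_all
    have new: "{a, b} \<notin> tree_edges s" using tree_edge_subset s(2) by fastforce
    have "{e \<in> tree_edges (Node l a r). v \<in> e} =
        (if v \<in> {a, b} then {{a, b}} else {}) \<union> {e \<in> tree_edges s. v \<in> e}"
      unfolding s(4) b by auto
    then have deg: "tree_degree (Node l a r) v = (if v \<in> {a, b} then 1 else 0) + tree_degree s v"
      using new finite_tree_edges[of s] by (auto simp: tree_degree_def)
    show ?thesis
    proof (cases "v = a")
      case True
      have "{e \<in> tree_edges s. a \<in> e} = {}" using tree_edge_subset s(2) by fast
      then have "tree_degree s a = 0" by (simp only: tree_degree_def card.empty)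
      then show ?thesis using deg True by simp
    next
      case False
      then have v: "v \<in> set_tree s" using Node.prems(2) unfolding s(3) by simp
      have "set_tree s \<noteq> {v}" if "v \<noteq> b" using that b(2) by auto
      then show ?thesis using IH[OF v] deg False b(1) by auto
    qed
  qed
qed simp

section \<open>Trees of unimodal words\<close>

lemma word_tree_min_first:
  assumes "\<And>x. x \<in> set w \<Longrightarrow> a < x"
  shows "word_tree (a # w) = Node Leaf a (word_tree w)"
proof -
  have "Min (set (a # w)) = a" using assms by (intro Min_eqI) (auto intro: less_imp_le)
  then show ?thesis by (simp add: Let_def)
qed

lemma word_tree_min_last:
  assumes "\<And>x. x \<in> set w \<Longrightarrow> a < x"
  shows "word_tree (w @ [a]) = Node (word_tree w) a Leaf"
proof -
  have "Min (set (w @ [a])) = a" using assms by (intro Min_eqI) (auto intro: less_imp_le)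
  moreover have "takeWhile (\<lambda>x. x \<noteq> a) (w @ [a]) = w" "dropWhile (\<lambda>x. x \<noteq> a) (w @ [a]) = [a]"
    using assms by (auto simp: takeWhile_append dropWhile_append)
  ultimately show ?thesis by (subst word_tree.simps) (simp_all add: Let_def)
qed

text \<open>Induction downwards on the smallest letter a: it stands at the right end of the word if
  it lies in B and at the left end otherwise, so it becomes a root with one empty subtree.\<close>

lemma word_tree_unimodal:
  assumes "a \<le> n"
  shows "path_tree (word_tree (filter (\<lambda>x. x \<notin> B) [a..<n] @ n # rev (filter (\<lambda>x. x \<in> B) [a..<n]))) \<and>
    set_tree (word_tree (filter (\<lambda>x. x \<notin> B) [a..<n] @ n # rev (filter (\<lambda>x. x \<in> B) [a..<n]))) = {a..n}"
  using assms
proof (induction a rule: inc_induct)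
  case base
  show ?case by (simp add: word_tree_min_first)
next
  case (step a)
  define w where
    "w = filter (\<lambda>x. x \<notin> B) [Suc a..<n] @ n # rev (filter (\<lambda>x. x \<in> B) [Suc a..<n])"
  have larger: "\<And>x. x \<in> set w \<Longrightarrow> a < x" using step.hyps by (auto simp: w_def)
  have word: "filter (\<lambda>x. x \<notin> B) [a..<n] @ n # rev (filter (\<lambda>x. x \<in> B) [a..<n]) =
      (if a \<in> B then w @ [a] else a # w)"
    using step.hyps by (simp add: upt_conv_Cons w_def)
  have tree: "word_tree (if a \<in> B then w @ [a] else a # w) =
      (if a \<in> B then Node (word_tree w) a Leaf else Node Leaf a (word_tree w))"
    using word_tree_min_first[OF larger] word_tree_min_last[OF larger] by presburger
  have "insert a {Suc a..n} = {a..n}" using step.hyps by auto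
  then show ?case
    unfolding word tree using step.IH[folded w_def] by (simp del: word_tree.simps)
qed

lemma descending_cycle_in_tS:
  assumes B: "B \<subseteq> {1..<n}" and n: "2 \<le> n"
  shows "cycle_of_list (descending_list n B) \<in> tS n"
proof -
  let ?t = "perm_tree n (cycle_of_list (descending_list n B))"
  \<comment> \<open>The singleton cycles spell the increasing run, the last cycle spells n and the
    descent.\<close>
  have "concat (canonical_cycles n (cycle_of_list (descending_list n B))) =
      filter (\<lambda>x. x \<notin> B) [1..<n] @ n # rev (filter (\<lambda>x. x \<in> B) [1..<n])"
    using n by (subst canonical_cycles_descending_cycle[OF B]) (simp_all add: descending_list_def)
  then have t: "path_tree ?t" "set_tree ?t = {1..n}"
    using word_tree_unimodal[of 1 n B] n by (simp_all add: perm_tree_def)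
  have "tree_degree ?t v \<in> {1, 2}" if v: "v \<in> set_tree ?t" for v
  proof -
    \<comment> \<open>With two vertices present, no vertex is isolated.\<close>
    have "1 \<in> set_tree ?t" "2 \<in> set_tree ?t" using t(2) n by auto
    then have "set_tree ?t \<noteq> {v}" by (metis numeral_eq_one_iff semiring_norm(85) singletonD)
    then show ?thesis using tree_degree_path_tree[OF t(1) v] by auto
  qed
  then show ?thesis using descending_cycle_permutes[OF B] n by (simp add: tS_def)
qed

lemma exponential_growth_tS: "exponential_growth tS"
proof (rule exponential_growth_subsetsI[where N = 2])
  fix n and B :: "nat set"
  assume B: "2 \<le> n" "B \<subseteq> {1..<n}"
  show "cycle_of_list (descending_list n B) \<in> tS n"
    using B by (intro descending_cycle_in_tS)
  show "{x. cycle_of_list (descending_list n B) x \<noteq> x} - {n} = B"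
    using B(2) by (rule moved_by_descending_cycle)
qed (auto simp: tS_def)

section \<open>Segment-simple permutations\<close>

(* In one-line notation: values at least v are shifted up by one, and v is appended at the end. *)
definition append_value :: "nat \<Rightarrow> (nat \<Rightarrow> nat) \<Rightarrow> nat \<Rightarrow> nat \<Rightarrow> nat"
  where "append_value n p v x =
    (if x = Suc n then v else if x \<in> {1..n} \<and> v \<le> p x then Suc (p x) else p x)"

lemma append_value_permutes:
  assumes p: "p permutes {1..n}" and v: "v \<in> {1..Suc n}"
  shows "append_value n p v permutes {1..Suc n}"
proof (rule bij_imp_permutes)
  have p_mem: "p x \<in> {1..n}" if "x \<in> {1..n}" for x using permutes_in_image[OF p] that by blast
  have "inj_on (append_value n p v) {1..Suc n}"
  proof (rule inj_onI)
    fix x y assume "x \<in> {1..Suc n}" "y \<in> {1..Suc n}" "append_value n p v x = append_value n p v y"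
    then show "x = y"
      using permutes_inj[OF p, THEN injD, of x y]
      by (auto simp: append_value_def le_Suc_eq split: if_splits)
  qed
  moreover have "append_value n p v ` {1..Suc n} \<subseteq> {1..Suc n}"
  proof
    fix y assume "y \<in> append_value n p v ` {1..Suc n}"
    then obtain x where "x \<in> {1..Suc n}" "y = append_value n p v x" by blast
    then show "y \<in> {1..Suc n}"
      using v p_mem[of x] by (cases "x = Suc n") (auto simp: append_value_def)
  qed
  ultimately show "bij_betw (append_value n p v) {1..Suc n} {1..Suc n}"
    by (simp add: bij_betw_def endo_inj_surj)
  show "append_value n p v x = x" if "x \<notin> {1..Suc n}" for x
    using that permutes_not_in[OF p, of x] by (auto simp: append_value_def)
qed

text \<open>The last value is v, and the shift around a known v can be undone.\<close>

lemma append_value_inject: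
  assumes p: "p permutes {1..n}" and q: "q permutes {1..n}"
    and eq: "append_value n p v = append_value n q w"
  shows "p = q \<and> v = w"
proof
  show vw: "v = w" using fun_cong[OF eq, of "Suc n"] by (simp add: append_value_def)
  show "p = q"
  proof
    fix x
    show "p x = q x"
    proof (cases "x \<in> {1..n}")
      case True
      then show ?thesis
        using fun_cong[OF eq, of x] vw by (auto simp: append_value_def split: if_splits)
    qed (use permutes_not_in[OF p] permutes_not_in[OF q] in simp)
  qed
qed

text \<open>From a bad segment of the new permutation, dropping the last position and collapsing the
  value v produces a segment of p with segment image. The degenerate outcomes {1..n} and {n} are
  ruled out by the conditions on v.\<close>

lemma append_value_in_sS:
  assumes p: "p \<in> sS n" and v: "v \<in> {2..n} - {p n, Suc (p n)}"
  shows "append_value n p v \<in> sS (Suc n)"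
proof -
  let ?q = "append_value n p v"
  \<comment> \<open>Left inverse of the shift: it closes the gap at v.\<close>
  define collapse where "collapse y = (if v < y then y - 1 else y)" for y
  have perm: "p permutes {1..n}" using p by (simp add: sS_def)
  have q_perm: "?q permutes {1..Suc n}" using append_value_permutes[OF perm] v by simp
  have collapse: "collapse (?q x) = p x" and q_neq: "?q x \<noteq> v" if "x \<in> {1..n}" for x
    using that by (auto simp: append_value_def collapse_def)
  have v_notin: "v \<notin> ?q ` J" if "J \<subseteq> {1..n}" for J
    using that by (metis imageE subsetD q_neq)
  have simple: "\<not> segment n (p ` {i..j})" if "1 \<le> i" "i < j" "j \<le> n" "(i, j) \<noteq> (1, n)" for i j
  proof -
    have "segment n {i..j}" using that by (auto simp: segment_def)
    moreover have "1 < card {i..j}" "card {i..j} < n" using that by auto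
    ultimately show ?thesis using p by (auto simp: sS_def)
  qed
  have "False" if I: "segment (Suc n) I" "1 < card I" "card I < Suc n" "segment (Suc n) (?q ` I)" for I
  proof -
    obtain i j where ij: "1 \<le> i" "j \<le> Suc n" "I = {i..j}" using I(1) by (auto simp: segment_def)
    obtain c d where cd: "1 \<le> c" "c \<le> d" "d \<le> Suc n" "?q ` I = {c..d}"
      using I(4) by (auto simp: segment_def)
    have lt: "i < j" using I(2) ij by simp
    have "card {c..d} = card {i..j}"
      using card_image[OF permutes_inj_on[OF q_perm], of I] cd(4) ij(3) by simp
    then have len: "d - c = j - i" using lt cd(2) by simp
    show False
    proof (cases "j = Suc n")
      case False
      then have j: "j \<le> n" using ij by simp
      have "p ` I = collapse ` {c..d}"
        unfolding cd(4)[symmetric] image_image using collapse ij j by (intro image_cong) auto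
      \<comment> \<open>Only position \<open>Suc n\<close> takes the value v, so {c..d} lies
        entirely above or entirely below v.\<close>
      moreover have notin: "v \<notin> {c..d}"
        unfolding cd(4)[symmetric] using ij j by (intro v_notin) auto
      moreover have "collapse ` {c..d} = (if v < c then {c - 1..d - 1} else {c..d})"
      proof (cases "v < c")
        case True
        have "collapse ` {c..d} = (\<lambda>y. y - 1) ` {c..d}"
          using True by (intro image_cong) (auto simp: collapse_def)
        also have "\<dots> = {c - 1..d - 1}"
        proof (intro equalityI subsetI)
          fix y assume "y \<in> {c - 1..d - 1}"
          then show "y \<in> (\<lambda>y. y - 1) ` {c..d}"
            using True cd(2) by (intro image_eqI[of _ _ "Suc y"]) auto
        qed auto
        finally show ?thesis using True by simp
      next
        case False
        then have "collapse ` {c..d} = (\<lambda>y. y) ` {c..d}"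
          using notin by (intro image_cong) (auto simp: collapse_def)
        then show ?thesis using False by simp
      qed
      ultimately have img: "p ` {i..j} = (if v < c then {c - 1..d - 1} else {c..d})"
        using ij(3) by simp
      have "segment n (p ` {i..j})"
      proof (cases "v < c")
        case True
        then show ?thesis
          unfolding segment_def img using cd v by (intro exI[of _ "c - 1"] exI[of _ "d - 1"]) auto
      next
        case False
        then have "d < v" using notin by auto
        then show ?thesis
          unfolding segment_def img using cd v False by (intro exI[of _ c] exI[of _ d]) auto
      qed
      then have "(i, j) = (1, n)" using simple ij(1) lt j by blast
      \<comment> \<open>Now {c..d} holds n of the values 1, ..., n + 1 and misses v, which forces v
        to be 1 or n + 1.\<close>
      then have "d - c = n - 1" using len by simp
      then show False using cd notin v by auto
    next
      case True
      then have I': "I = insert (Suc n) {i..n}" using ij lt by auto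
      have qv: "?q (Suc n) = v" by (simp add: append_value_def)
      have vin: "v \<in> {c..d}" using cd(4) I' qv by auto
      have "?q ` {i..n} = {c..d} - {v}"
      proof -
        have "v \<notin> ?q ` {i..n}" using ij by (intro v_notin) auto
        then show ?thesis unfolding cd(4)[symmetric] I' using qv by auto
      qed
      then have "collapse ` ({c..d} - {v}) = (\<lambda>x. collapse (?q x)) ` {i..n}"
        by (metis image_image)
      also have "\<dots> = p ` {i..n}" using collapse ij by (intro image_cong) auto
      finally have "p ` {i..n} = collapse ` ({c..d} - {v})" ..
      also have "\<dots> = {c..d - 1}"
      proof (intro equalityI subsetI)
        fix y assume "y \<in> {c..d - 1}"
        then show "y \<in> collapse ` ({c..d} - {v})"
          using vin cd by (intro image_eqI[of _ _ "if y < v then y else Suc y"]) (auto simp: collapse_def)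
      qed (use vin in \<open>auto simp: collapse_def\<close>)
      finally have img: "p ` {i..n} = {c..d - 1}" .
      have cd': "c < d" using len lt by simp
      have "segment n (p ` {i..n})"
        unfolding segment_def img using cd cd' by (intro exI[of _ c] exI[of _ "d - 1"]) auto
      moreover have "i \<noteq> 1" using I(3) ij True by auto
      \<comment> \<open>Simplicity leaves only the one-element segment {n}; then {c..d} is {p n, p n
        + 1}, the values forbidden for v.\<close>
      ultimately have "i = n" using simple[of i n] ij True lt by fastforce
      then have "{p n} = {c..d - 1}" using img by simp
      moreover have "d - c = 1" using len True \<open>i = n\<close> by simp
      moreover from this have d: "d = Suc c" by simp
      ultimately have "p n = c" by simp
      then show False using vin v d by auto
    qed
  qed
  then show ?thesis using q_perm by (auto simp: sS_def)
qed

section \<open>Growth of the number of segment-simple permutations\<close>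

lemma finite_sS: "finite (sS n)"
  by (rule finite_subset[OF _ finite_permutations[of "{1..n}"]]) (auto simp: sS_def)

text \<open>Of the n - 1 values in {2..n} at most two are forbidden, and distinct pairs (p, v) give
  distinct extensions.\<close>

lemma card_sS_Suc: "(n - 3) * card (sS n) \<le> card (sS (Suc n))"
proof -
  let ?V = "\<lambda>p. {2..n} - {p n, Suc (p n)}"
  have V: "n - 3 \<le> card (?V p)" for p :: "nat \<Rightarrow> nat"
  proof -
    have "card {2..n} - card {p n, Suc (p n)} \<le> card (?V p)" by (rule diff_card_le_card_Diff) simp
    then show ?thesis by simp
  qed
  have "(n - 3) * card (sS n) \<le> (\<Sum>p\<in>sS n. card (?V p))"
    using sum_bounded_below[of "sS n" "n - 3" "\<lambda>p. card (?V p)"] V by (simp add: mult.commute)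
  also have "\<dots> = card (Sigma (sS n) ?V)" using finite_sS by (subst card_SigmaI) auto
  also have "\<dots> \<le> card (sS (Suc n))"
  proof (rule card_inj_on_le)
    show "inj_on (\<lambda>(p, v). append_value n p v) (Sigma (sS n) ?V)"
    proof (rule inj_onI)
      fix x y
      assume "x \<in> Sigma (sS n) ?V" "y \<in> Sigma (sS n) ?V"
        "(case x of (p, v) \<Rightarrow> append_value n p v) = (case y of (p, v) \<Rightarrow> append_value n p v)"
      then show "x = y"
        using append_value_inject[of "fst x" n "fst y" "snd x" "snd y"]
        by (auto simp: sS_def)
    qed
    show "(\<lambda>(p, v). append_value n p v) ` Sigma (sS n) ?V \<subseteq> sS (Suc n)"
      by (auto intro!: append_value_in_sS)
  qed (rule finite_sS)
  finally show ?thesis .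
qed

text \<open>The witness is 2 4 1 3 in one-line notation; it starts the recursion.\<close>

lemma sS_4_nonempty: "sS 4 \<noteq> {}"
proof -
  let ?p = "cycle_of_list [1, 2, 4, 3::nat]"
  have p: "?p 1 = 2" "?p 2 = 4" "?p 3 = 1" "?p 4 = 3" by (simp_all add: transpose_def)
  have "set [1, 2, 4, 3] = {1..4::nat}" by auto
  then have "?p permutes {1..4}" by (metis cycle_permutes)
  moreover have "False"
    if I: "segment 4 I" "1 < card I" "card I < 4" "segment 4 (?p ` I)" for I
  proof -
    obtain i j where ij: "1 \<le> i" "j \<le> 4" "I = {i..j}" using I(1) by (auto simp: segment_def)
    obtain c d where cd: "?p ` I = {c..d}" using I(4) by (auto simp: segment_def)
    have "?p x \<in> {c..d} \<longleftrightarrow> x \<in> {i..j}" for x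
      unfolding cd[symmetric] ij(3) using permutes_inj[OF cycle_permutes] by (rule inj_image_mem_iff)
    from this[of 1] this[of 2] this[of 3] this[of 4]
    have mem: "2 \<in> {c..d} \<longleftrightarrow> 1 \<in> {i..j}" "4 \<in> {c..d} \<longleftrightarrow> 2 \<in> {i..j}"
      "1 \<in> {c..d} \<longleftrightarrow> 3 \<in> {i..j}" "3 \<in> {c..d} \<longleftrightarrow> 4 \<in> {i..j}"
      by (simp_all only: p)
    have "i < j" "j < i + 3" using I(2,3) ij(3) by simp_all
    then show False using mem ij(1,2) unfolding atLeastAtMost_iff by presburger
  qed
  ultimately have "?p \<in> sS 4" unfolding sS_def by blast
  then show ?thesis by blast
qed

text \<open>The factor in \<open>card_sS_Suc\<close> is at least 2 from n = 5 on; the passage from 4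
  to 5 has factor 1 and gives the base case.\<close>

lemma card_sS_ge: "2 ^ k \<le> card (sS (k + 5))"
proof (induction k)
  case 0
  have "card (sS 4) \<noteq> 0" using sS_4_nonempty finite_sS by simp
  then show ?case using card_sS_Suc[of 4] by simp
next
  case (Suc k)
  have "2 ^ Suc k \<le> 2 * card (sS (k + 5))" using Suc by simp
  also have "\<dots> \<le> (k + 5 - 3) * card (sS (k + 5))" by (intro mult_right_mono) auto
  also have "\<dots> \<le> card (sS (Suc k + 5))" using card_sS_Suc[of "k + 5"] by simp
  finally show ?case .
qed

lemma exponential_growth_sS: "exponential_growth sS"
proof (rule exponential_growthI[where N = 10])
  fix n :: nat assume "10 \<le> n"
  \<comment> \<open>Half of n is at most n - 5 here, the exponent obtained from
    \<open>card_sS_ge\<close>.\<close>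
  then have "n div 2 \<le> n - 5" and n: "n - 5 + 5 = n" by auto
  then have "2 ^ (n div 2) \<le> (2::nat) ^ (n - 5)" by simp
  also have "\<dots> \<le> card (sS n)" using card_sS_ge[of "n - 5"] n by simp
  finally show "2 ^ (n div 2) \<le> card (sS n)" .
qed

theorem theorem1p8:
  shows "exponential_growth sS \<and> exponential_growth cS \<and> exponential_growth gS \<and>
    exponential_growth bS \<and> exponential_growth tS"
  using exponential_growth_sS exponential_growth_cS exponential_growth_gS
    exponential_growth_bS exponential_growth_tS by blast

end
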